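(* Fix real numbers $1 \le T \le n$, and let $v = \left(\frac{1}{n}, \frac{1}{n}, \dots, \frac{1}{n}\right) \in \mathbb{R}^n$. There exists an absolute constant $c > 0$ such that for every integer $k \le c \cdot n/T$ and every real matrix $A \in \mathbb{R}^{k \times n}$, there exists $x \in \mathbb{R}^n$ with $Ax = Av$, all entries of $x$ nonnegative, and $\max_i x_i \ge T/n$. *)

theory Defs
  imports Complex_Main "Jordan_Normal_Form.Matrix"
begin

end

theory Submission
  imports Defs "Jordan_Normal_Form.Determinant"
begin

text \<open>Adjoin the all-ones row to \<open>A\<close>. By the conic Caratheodory theorem the resulting \<open>k + 1\<close>
  linear equations have a nonnegative solution supported on at most \<open>k + 1\<close> coordinates. Its entries
  sum to \<open>1\<close>, so one of them is at least \<open>1 / (k + 1) \<ge> T / n\<close>; this works with \<open>c = 1 / 2\<close>.\<close>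

text \<open>Padding the \<open>r\<close> equations with zero rows gives a singular square matrix,
  and a nonzero kernel vector supplies \<open>w\<close>. The unknowns are indexed by an arbitrary
  finite set because the lemma is applied below to the support of a vector.\<close>

lemma homogeneous_system_nontrivial_solution:
  fixes a :: "nat \<Rightarrow> 'a \<Rightarrow> 'b::field"
  assumes "finite S" and "r < card S"
  shows "\<exists>w. (\<exists>s\<in>S. w s \<noteq> 0) \<and> (\<forall>i<r. (\<Sum>s\<in>S. a i s * w s) = 0)"
proof -
  define m where "m = card S"
  obtain h where h: "bij_betw h {0..<m} S"
    using assms(1) ex_bij_betw_nat_finite m_def by blast
  define C where "C = mat m m (\<lambda>(i, j). if i < r then a i (h j) else 0)"
  have C: "C \<in> carrier_mat m m" by (simp add: C_def)
  \<comment> \<open>Since \<open>r < m\<close>, row \<open>r\<close> is one of the zero rows.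
    Displaying it explicitly is the form that \<open>det_row_0\<close> expects.\<close>
  have "C = mat\<^sub>r m m (\<lambda>i. if i = r then 0\<^sub>v m else row C i)"
    by (intro eq_matI) (auto simp: C_def)
  then have "det C = 0"
    using det_row_0[of r m "row C"] assms(2) C by (simp add: m_def)
  then obtain u where u: "u \<in> carrier_vec m" "u \<noteq> 0\<^sub>v m" "C *\<^sub>v u = 0\<^sub>v m"
    using det_0_iff_vec_prod_zero_field[OF C] by blast
  obtain j where j: "j < m" "u $ j \<noteq> 0"
    using u(1,2) by (metis carrier_vecD eq_vecI index_zero_vec)
  define w where "w s = u $ (inv_into {0..<m} h s)" for s
  have w: "w (h j) = u $ j" if "j < m" for j
    using that h by (simp add: w_def bij_betw_def inv_into_f_f)
  have "(\<Sum>s\<in>S. a i s * w s) = 0" if "i < r" for i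
  proof -
    have i: "i < m" using that assms(2) m_def by simp
    have "(\<Sum>s\<in>S. a i s * w s) = (\<Sum>j = 0..<m. a i (h j) * w (h j))"
      by (rule sum.reindex_bij_betw[OF h, symmetric])
    also have "\<dots> = (C *\<^sub>v u) $ i"
      using i that u(1) by (auto simp: C_def scalar_prod_def w intro!: sum.cong)
    also have "\<dots> = 0" using u(3) i by simp
    finally show ?thesis .
  qed
  moreover have "h j \<in> S" using h j(1) by (auto simp: bij_betw_def)
  ultimately show ?thesis using w j by metis
qed

text \<open>The reduction step of Caratheodory's argument: with more than \<open>r\<close> nonzero
  coordinates there is a kernel direction supported on them, and moving along it until the first
  coordinate reaches zero keeps all equations and shrinks the support.\<close>

lemma nonneg_solution_smaller_support:
  fixes a :: "nat \<Rightarrow> 'a \<Rightarrow> real"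
  assumes "finite S" and nonneg: "\<forall>s\<in>S. 0 \<le> x s" and large: "r < card {s\<in>S. x s \<noteq> 0}"
  shows "\<exists>y. (\<forall>s\<in>S. 0 \<le> y s) \<and> (\<forall>i<r. (\<Sum>s\<in>S. a i s * y s) = (\<Sum>s\<in>S. a i s * x s)) \<and>
    card {s\<in>S. y s \<noteq> 0} < card {s\<in>S. x s \<noteq> 0}"
proof -
  define P where "P = {s\<in>S. x s \<noteq> 0}"
  have P: "finite P" "P \<subseteq> S" using assms(1) by (auto simp: P_def)
  obtain w0 where w0: "\<exists>s\<in>P. w0 s \<noteq> 0" "\<forall>i<r. (\<Sum>s\<in>P. a i s * w0 s) = 0"
    using homogeneous_system_nontrivial_solution[OF P(1), of r a] large P_def by auto
  \<comment> \<open>Replacing \<open>w0\<close> by its negative if necessary gives a direction with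
    a negative entry, along which the nonnegative orthant is eventually left.\<close>
  obtain w where w: "\<exists>s\<in>P. w s < 0" "\<forall>i<r. (\<Sum>s\<in>P. a i s * w s) = 0"
  proof (cases "\<exists>s\<in>P. w0 s < 0")
    case True
    then show ?thesis using that w0 by blast
  next
    case False
    then have "\<exists>s\<in>P. - w0 s < 0" using w0(1) by force
    moreover have "\<forall>i<r. (\<Sum>s\<in>P. a i s * - w0 s) = 0"
      using w0(2) by (simp add: sum_negf)
    ultimately show ?thesis by (rule that[of "\<lambda>s. - w0 s"])
  qed
  define N where "N = {s\<in>P. w s < 0}"
  have N: "finite N" "N \<noteq> {}" using P w by (auto simp: N_def)
  \<comment> \<open>The ratio test: \<open>t\<close> is the largest step for which
    \<open>x + t * w\<close> stays nonnegative, and a minimizing index \<open>p\<close> is a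
    coordinate that becomes exactly zero.\<close>
  define t where "t = Min ((\<lambda>s. x s / - w s) ` N)"
  have "t \<in> (\<lambda>s. x s / - w s) ` N" using N unfolding t_def by (intro Min_in) auto
  then obtain p where p: "p \<in> N" "t = x p / - w p" by auto
  have t_le: "t \<le> x s / - w s" if "s \<in> N" for s
    using that N unfolding t_def by (intro Min_le) auto
  have t0: "0 \<le> t"
    using p nonneg P(2) by (auto simp: N_def intro!: divide_nonneg_neg)
  define y where "y s = (if s \<in> P then x s + t * w s else 0)" for s
  have y_nonneg: "0 \<le> y s" if "s \<in> S" for s
  proof (cases "s \<in> N")
    case True
    then show ?thesis using t_le[OF True] by (simp add: y_def N_def field_simps)
  next
    case False
    then show ?thesis using that nonneg t0 by (auto simp: y_def N_def)
  qed
  have "(\<Sum>s\<in>S. a i s * y s) = (\<Sum>s\<in>S. a i s * x s)" if "i < r" for i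
  proof -
    have "(\<Sum>s\<in>S. a i s * y s) = (\<Sum>s\<in>P. a i s * y s)"
      using P assms(1) by (intro sum.mono_neutral_right) (auto simp: y_def)
    also have "\<dots> = (\<Sum>s\<in>P. a i s * x s + t * (a i s * w s))"
      by (intro sum.cong) (auto simp: y_def algebra_simps)
    also have "\<dots> = (\<Sum>s\<in>P. a i s * x s)"
      using w(2) that by (simp add: sum.distrib flip: sum_distrib_left)
    also have "\<dots> = (\<Sum>s\<in>S. a i s * x s)"
      using assms(1) by (intro sum.mono_neutral_left) (auto simp: P_def)
    finally show ?thesis .
  qed
  \<comment> \<open>No coordinate outside \<open>P\<close> becomes nonzero, while \<open>p\<close>
    drops out of the support.\<close>
  moreover have "{s\<in>S. y s \<noteq> 0} \<subset> P"
  proof -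
    have "y p = 0" "p \<in> P" using p by (auto simp: y_def N_def)
    then show ?thesis by (auto simp: y_def)
  qed
  ultimately show ?thesis
    using y_nonneg psubset_card_mono[OF P(1)] unfolding P_def by blast
qed

text \<open>The reduction step is iterated, by strong induction on the size of the support, until at
  most \<open>r\<close> coordinates remain.\<close>

lemma nonneg_solution_small_support:
  fixes a :: "nat \<Rightarrow> 'a \<Rightarrow> real"
  assumes "finite S" and "\<forall>s\<in>S. 0 \<le> v s"
  shows "\<exists>x. (\<forall>s\<in>S. 0 \<le> x s) \<and> (\<forall>i<r. (\<Sum>s\<in>S. a i s * x s) = (\<Sum>s\<in>S. a i s * v s)) \<and>
    card {s\<in>S. x s \<noteq> 0} \<le> r"
  using assms(2)
proof (induction "card {s\<in>S. v s \<noteq> 0}" arbitrary: v rule: less_induct)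
  case less
  show ?case
  proof (cases "card {s\<in>S. v s \<noteq> 0} \<le> r")
    case True
    then show ?thesis using less.prems by blast
  next
    case False
    then obtain y where y: "\<forall>s\<in>S. 0 \<le> y s"
      "\<forall>i<r. (\<Sum>s\<in>S. a i s * y s) = (\<Sum>s\<in>S. a i s * v s)"
      "card {s\<in>S. y s \<noteq> 0} < card {s\<in>S. v s \<noteq> 0}"
      using nonneg_solution_smaller_support[OF assms(1) less.prems, of r a] by auto
    show ?thesis using less.hyps[OF y(3,1)] y(2) by simp
  qed
qed

theorem mainTheorem1:
  shows "\<exists>c::real. c > 0 \<and>
    (\<forall>(n::nat) (T::real). 1 \<le> T \<and> T \<le> real n \<longrightarrow>
      (\<forall>(k::nat) (A::real mat). real k \<le> c * real n / T \<and> A \<in> carrier_mat k n \<longrightarrow>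
        (\<exists>x \<in> carrier_vec n.
           A *\<^sub>v x = A *\<^sub>v (vec n (\<lambda>_. 1 / real n)) \<and>
           (\<forall>i<n. 0 \<le> x $ i) \<and>
           Max {x $ i | i. i < n} \<ge> T / real n)))"
proof (intro exI[of _ "1/2"] conjI allI impI)
  show "(0::real) < 1/2" by simp
next
  fix n k :: nat and T :: real and A :: "real mat"
  assume "1 \<le> T \<and> T \<le> real n" and "real k \<le> 1/2 * real n / T \<and> A \<in> carrier_mat k n"
  then have T: "1 \<le> T" "T \<le> real n" and k: "real k \<le> 1/2 * real n / T" and A: "A \<in> carrier_mat k n"
    by auto
  have n: "0 < n" using T by (cases n) auto
  \<comment> \<open>The constant \<open>1/2\<close> comes from \<open>k + 1 \<le> 2 * k\<close>,
    valid for \<open>k \<ge> 1\<close>. For \<open>k = 0\<close> the bound is just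
    \<open>T \<le> n\<close>.\<close>
  have k_bound: "real (k + 1) * (T / real n) \<le> 1"
  proof (cases "k = 0")
    case True
    then show ?thesis using T n by simp
  next
    case False
    then have "real (k + 1) * T \<le> 2 * real k * T" using T(1) by (intro mult_right_mono) auto
    also have "\<dots> \<le> real n" using k T(1) by (simp add: field_simps)
    finally show ?thesis using n by (simp add: field_simps)
  qed
  \<comment> \<open>Indices below \<open>k\<close> give the rows of \<open>A\<close>; index
    \<open>k\<close> gives the adjoined all-ones row, whose equation fixes the sum of the entries at
    \<open>1\<close>.\<close>
  define a where "a i s = (if i < k then A $$ (i, s) else 1)" for i s
  obtain x where x: "\<forall>s\<in>{0..<n}. 0 \<le> x s"
    "\<forall>i<k + 1. (\<Sum>s = 0..<n. a i s * x s) = (\<Sum>s = 0..<n. a i s * (1 / real n))"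
    "card {s\<in>{0..<n}. x s \<noteq> 0} \<le> k + 1"
    using nonneg_solution_small_support[of "{0..<n}" "\<lambda>_. 1 / real n" "k + 1" a] by auto
  define Q where "Q = {s\<in>{0..<n}. x s \<noteq> 0}"
  have sum_x: "(\<Sum>s = 0..<n. x s) = 1"
    using x(2)[rule_format, of k] n by (simp add: a_def)
  have "(\<Sum>s\<in>Q. x s) = (\<Sum>s = 0..<n. x s)"
    by (intro sum.mono_neutral_left) (auto simp: Q_def)
  then have sum_Q: "(\<Sum>s\<in>Q. x s) = 1" using sum_x by simp
  have "finite Q" by (simp add: Q_def)
  have "Q \<noteq> {}" using sum_Q by force
  \<comment> \<open>Averaging: if all of the at most \<open>k + 1\<close> entries on
    \<open>Q\<close> were below \<open>T / n\<close>, their sum would be less than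
    \<open>(k + 1) * (T / n) \<le> 1\<close>.\<close>
  have "\<exists>s\<in>Q. T / real n \<le> x s"
  proof (rule ccontr)
    assume "\<not> ?thesis"
    then have "(\<Sum>s\<in>Q. x s) < (\<Sum>s\<in>Q. T / real n)"
      using \<open>finite Q\<close> \<open>Q \<noteq> {}\<close> by (intro sum_strict_mono) (auto simp: not_le)
    also have "\<dots> \<le> real (k + 1) * (T / real n)"
      using x(3) T(1) by (simp add: Q_def divide_right_mono)
    finally show False using sum_Q k_bound by simp
  qed
  then obtain s where s: "s < n" "T / real n \<le> x s" by (auto simp: Q_def)
  show "\<exists>x \<in> carrier_vec n.
           A *\<^sub>v x = A *\<^sub>v (vec n (\<lambda>_. 1 / real n)) \<and>
           (\<forall>i<n. 0 \<le> x $ i) \<and>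
           Max {x $ i | i. i < n} \<ge> T / real n"
  proof (intro bexI[of _ "vec n x"] conjI allI impI)
    show "A *\<^sub>v vec n x = A *\<^sub>v vec n (\<lambda>_. 1 / real n)"
    proof (rule eq_vecI)
      fix i assume "i < dim_vec (A *\<^sub>v vec n (\<lambda>_. 1 / real n))"
      then have i: "i < k" using A by simp
      then show "(A *\<^sub>v vec n x) $ i = (A *\<^sub>v vec n (\<lambda>_. 1 / real n)) $ i"
        using A x(2)[rule_format, of i] by (simp add: scalar_prod_def a_def)
    qed simp
    have "x s \<le> Max {vec n x $ i | i. i < n}"
      using s(1) by (intro Max_ge) (auto intro!: exI[of _ s])
    then show "T / real n \<le> Max {vec n x $ i | i. i < n}" using s(2) by simp
  qed (use x(1) in auto)
qed

end
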